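(* Let $K\subset\mathbb{R}^n$ be a non-empty closed set. Then for every $x\in\mathbb{R}^n$, $$\lim_{\lambda\to+\infty}M_\lambda(x;K)=M_\infty(x;K).$$
   Context: $|\cdot|$ is the Euclidean norm on $\mathbb{R}^n$ and $\mathrm{dist}(x;E)=\inf\{|x-y|: y\in E\}$ for non-empty $E$. For a continuous function $f:\mathbb{R}^n\to\mathbb{R}$ bounded below, $\mathrm{co}[f]$ denotes the convex envelope, i.e. the largest convex function not greater than $f$; for a set $E$, $\mathrm{co}[E]$ is its convex hull. For $\lambda>0$ the lower compensated convex transform is $C^l_\lambda(f)(x)=\mathrm{co}[f+\lambda|\cdot|^2](x)-\lambda|x|^2$. The quadratic multiscale medial axis map of $K$ with scale $\lambda>0$ is $M_\lambda(x;K)=(1+\lambda)\big(\mathrm{dist}^2(x;K)-C^l_\lambda(\mathrm{dist}^2(\cdot;K))(x)\big)$. With $r(x)=\mathrm{dist}(x;K)$, put $K(x)=\overline{B}(x;r(x))\cap K$, where $\overline{B}(x;r)$ is the closed ball with centre $x$ and radius $r$ (i.e. $K(x)$ is the set of points of $K$ nearest to $x$). The quadratic multiscale medial axis landscape map of $K$ is $M_\infty(x;K)=\mathrm{dist}^2(x;K)-\mathrm{dist}^2(x;\mathrm{co}[K(x)])$. *)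

theory Defs
  imports "HOL-Analysis.Analysis"
begin

text \<open>Functions are ordered pointwise, so the following is the largest convex function
  not greater than f. It is meaningful when f is bounded below (see below).\<close>

definition convex_envelope :: "('a::real_vector \<Rightarrow> real) \<Rightarrow> 'a \<Rightarrow> real" where
  "convex_envelope f = (GREATEST g. convex_on UNIV g \<and> g \<le> f)"

lemma convex_envelope_SUP:
  fixes f :: "'a::real_vector \<Rightarrow> real"
  assumes "bdd_below (range f)"
  defines "G \<equiv> {g. convex_on UNIV g \<and> g \<le> f}"
  shows "convex_envelope f = (\<lambda>x. SUP g\<in>G. g x)"
    and "convex_on UNIV (convex_envelope f)"
    and "convex_envelope f \<le> f"
    and "\<And>g. convex_on UNIV g \<Longrightarrow> g \<le> f \<Longrightarrow> g \<le> convex_envelope f"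
proof -
  obtain c where c: "\<And>x. c \<le> f x"
    using assms(1) by (auto simp: bdd_below_def)
  have ne: "G \<noteq> {}"
  proof -
    have "(\<lambda>x. c) \<in> G"
      using c by (simp add: G_def le_fun_def convex_on_const)
    then show ?thesis by blast
  qed
  have le: "g x \<le> f x" if "g \<in> G" for g x
    using that by (simp add: G_def le_fun_def)
  then have bdd: "bdd_above ((\<lambda>g. g x) ` G)" for x
    by (auto simp: bdd_above_def)
  define S where "S = (\<lambda>x. SUP g\<in>G. g x)"
  have up: "g x \<le> S x" if "g \<in> G" for g x
    unfolding S_def using bdd that by (rule cSUP_upper2) simp
  have Sf: "S \<le> f"
    unfolding S_def le_fun_def using le ne by (auto intro: cSUP_least)
  have conv: "convex_on UNIV S"
  proof (rule convex_onI)
    fix t :: real and x y :: 'a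
    assume t: "0 < t" "t < 1"
    show "S ((1 - t) *\<^sub>R x + t *\<^sub>R y) \<le> (1 - t) * S x + t * S y"
      unfolding S_def[THEN fun_cong, of "(1 - t) *\<^sub>R x + t *\<^sub>R y"]
    proof (rule cSUP_least[OF ne])
      fix g assume g: "g \<in> G"
      have "g ((1 - t) *\<^sub>R x + t *\<^sub>R y) \<le> (1 - t) * g x + t * g y"
        using g t by (auto simp: G_def intro!: convex_onD)
      also have "\<dots> \<le> (1 - t) * S x + t * S y"
        using up[OF g] t by (intro add_mono mult_left_mono) auto
      finally show "g ((1 - t) *\<^sub>R x + t *\<^sub>R y) \<le> (1 - t) * S x + t * S y" .
    qed
  qed simp
  have great: "g \<le> S" if "convex_on UNIV g" "g \<le> f" for g
    using up that by (simp add: G_def le_fun_def)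
  have eq: "convex_envelope f = S"
    unfolding convex_envelope_def using conv Sf great by (intro Greatest_equality) auto
  show "convex_envelope f = (\<lambda>x. SUP g\<in>G. g x)" using eq by (simp add: S_def)
  show "convex_on UNIV (convex_envelope f)" "convex_envelope f \<le> f"
    "\<And>g. convex_on UNIV g \<Longrightarrow> g \<le> f \<Longrightarrow> g \<le> convex_envelope f"
    using eq conv Sf great by auto
qed

definition lower_transform :: "real \<Rightarrow> (real^'n \<Rightarrow> real) \<Rightarrow> real^'n \<Rightarrow> real" where
  "lower_transform l f x =
     convex_envelope (\<lambda>y. f y + l * (norm y)\<^sup>2) x - l * (norm x)\<^sup>2"

definition multiscale_medial_axis_map :: "real \<Rightarrow> (real^'n) set \<Rightarrow> real^'n \<Rightarrow> real" where
  "multiscale_medial_axis_map l K x =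
     (1 + l) * ((infdist x K)\<^sup>2 - lower_transform l (\<lambda>y. (infdist y K)\<^sup>2) x)"

definition nearest_points :: "(real^'n) set \<Rightarrow> real^'n \<Rightarrow> (real^'n) set" where
  "nearest_points K x = cball x (infdist x K) \<inter> K"

definition medial_axis_landscape_map :: "(real^'n) set \<Rightarrow> real^'n \<Rightarrow> real" where
  "medial_axis_landscape_map K x =
     (infdist x K)\<^sup>2 - (infdist x (convex hull (nearest_points K x)))\<^sup>2"

end

theory Submission
  imports Defs
begin

text \<open>Completing the square around \<open>x\<close>, with \<open>r = dist(x;K)\<close>, \<open>z = y - x\<close> and \<open>j = k - x\<close>,
  one has \<open>|y - k|\<^sup>2 + \<lambda>|z|\<^sup>2 = (1 + \<lambda>)|z|\<^sup>2 - 2 j \<bullet> z + |j|\<^sup>2\<close>. Let \<open>p\<close> be the point of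
  \<open>co[K(x)]\<close> nearest to \<open>x\<close>. Writing \<open>p\<close> as a convex combination of points \<open>k\<close> of \<open>K(x)\<close>
  represents \<open>x\<close> as the same convex combination of the points \<open>x + (k - p)/(1 + \<lambda>)\<close>; this bounds
  the envelope from above and gives \<open>M\<^sub>\<lambda> \<ge> M\<^sub>\<infinity>\<close> for every \<open>\<lambda> > 0\<close>. An affine
  minorant of slope \<open>-2(p - x)\<close> (relative to \<open>\<lambda>|\<cdot>|\<^sup>2\<close>) bounds it from below and gives
  \<open>M\<^sub>\<lambda> \<le> M\<^sub>\<infinity> + \<epsilon>\<close>, provided \<open>\<lambda>(|j|\<^sup>2 - r\<^sup>2) + 2 j \<bullet> (p - x) - 2|p - x|\<^sup>2 \<ge> -\<epsilon>\<close> for all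
  \<open>k \<in> K\<close>. That holds for large \<open>\<lambda>\<close>, since the \<open>k \<in> K\<close> with
  \<open>j \<bullet> (p - x) \<le> |p - x|\<^sup>2 - \<epsilon>/2\<close> stay at a distance from \<open>x\<close> bounded away from \<open>r\<close>.\<close>

lemma bdd_below_infdist_sq_plus:
  fixes K :: "'a::real_normed_vector set"
  assumes "l \<ge> 0"
  shows "bdd_below (range (\<lambda>y. (infdist y K)\<^sup>2 + l * (norm y)\<^sup>2))"
  using assms by (intro bdd_belowI[of _ 0]) auto

lemma nearest_points_iff:
  assumes "K \<noteq> {}"
  shows "k \<in> nearest_points K x \<longleftrightarrow> k \<in> K \<and> dist x k = infdist x K"
  using infdist_le[of k K x] by (auto simp: nearest_points_def)

lemma compact_nearest_points:
  assumes "closed K"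
  shows "compact (nearest_points K x)"
  using assms by (simp add: nearest_points_def compact_Int_closed)

lemma nearest_points_nonempty:
  assumes "K \<noteq> {}" "closed K"
  shows "nearest_points K x \<noteq> {}"
  using infdist_attains_inf[OF assms(2,1), of x] nearest_points_iff[OF assms(1)] by (metis empty_iff)

text \<open>The last property is the obtuse-angle criterion for the projection \<open>p\<close> of
  \<open>x\<close> onto a closed convex set. It is the only trace of minimality that the lower bound
  on the envelope needs.\<close>

lemma medial_axis_landscape_map_closest_point:
  fixes K :: "(real^'n) set"
  assumes "K \<noteq> {}" "closed K"
  obtains p where "p \<in> convex hull nearest_points K x"
    and "medial_axis_landscape_map K x = (infdist x K)\<^sup>2 - (norm (p - x))\<^sup>2"
    and "\<And>k. k \<in> nearest_points K x \<Longrightarrow> (norm (p - x))\<^sup>2 \<le> (k - x) \<bullet> (p - x)"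
proof -
  let ?H = "convex hull nearest_points K x"
  have cl: "closed ?H"
    using compact_nearest_points[OF assms(2)] by (simp add: compact_convex_hull compact_imp_closed)
  moreover have "?H \<noteq> {}" using nearest_points_nonempty[OF assms] by simp
  ultimately obtain p where p: "p \<in> ?H" "infdist x ?H = dist x p"
    using infdist_attains_inf by blast
  show thesis
  proof
    show "p \<in> ?H" by (fact p)
    show "medial_axis_landscape_map K x = (infdist x K)\<^sup>2 - (norm (p - x))\<^sup>2"
      by (simp add: medial_axis_landscape_map_def p(2) dist_norm norm_minus_commute)
    fix k assume "k \<in> nearest_points K x"
    then have "k \<in> ?H" by (rule hull_inc)
    moreover have "\<forall>z\<in>?H. dist x p \<le> dist x z"
      using infdist_le[of _ ?H x] p(2) by auto
    ultimately have "(x - p) \<bullet> (k - p) \<le> 0"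
      using any_closest_point_dot cl p(1) convex_convex_hull by blast
    then show "(norm (p - x))\<^sup>2 \<le> (k - x) \<bullet> (p - x)"
      by (simp add: power2_norm_eq_inner inner_diff inner_commute)
  qed
qed

lemma convex_envelope_infdist_sq_le:
  fixes K :: "(real^'n) set"
  assumes K: "K \<noteq> {}" and l: "l > 0" and p: "p \<in> convex hull nearest_points K x"
  shows "convex_envelope (\<lambda>y. (infdist y K)\<^sup>2 + l * (norm y)\<^sup>2) x
    \<le> (infdist x K)\<^sup>2 + l * (norm x)\<^sup>2 + ((norm (p - x))\<^sup>2 - (infdist x K)\<^sup>2) / (1 + l)"
proof -
  define F where "F = (\<lambda>y::real^'n. (infdist y K)\<^sup>2 + l * (norm y)\<^sup>2)"
  define G where "G = convex_envelope F"
  define m where "m = 1 + l"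
  have m: "m > 0" using l by (simp add: m_def)
  have bdd: "bdd_below (range F)"
    unfolding F_def using l by (intro bdd_below_infdist_sq_plus) simp
  have G: "convex_on UNIV G" and GF: "G y \<le> F y" for y
    using convex_envelope_SUP(2,3)[OF bdd] by (auto simp: G_def le_fun_def)
  define c where "c = (infdist x K)\<^sup>2 + l * (norm x)\<^sup>2 + ((norm (p - x))\<^sup>2 - (infdist x K)\<^sup>2) / m"
  define Y where "Y = (\<lambda>k. x + (1/m) *\<^sub>R (k - p))"
  \<comment> \<open>Jensen's inequality without explicit weights: \<open>Y\<close> is affine with
    \<open>Y p = x\<close>, and the term added to \<open>c\<close>, the cross term of
    \<open>l * (norm (Y k))\<^sup>2\<close>, is affine in \<open>k\<close> and vanishes at
    \<open>k = p\<close>. So \<open>p \<in> S\<close> is the claim, and it suffices that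
    \<open>S\<close> is convex and contains the nearest points.\<close>
  define S where "S = {k. G (Y k) \<le> c + (2 * l / m) * ((k - p) \<bullet> x)}"
  have "convex S"
  proof (rule convexI)
    fix a b :: "real^'n" and u v :: real
    assume ab: "a \<in> S" "b \<in> S" and uv: "0 \<le> u" "0 \<le> v" "u + v = 1"
    have v: "v = 1 - u" using uv by simp
    have "Y (u *\<^sub>R a + v *\<^sub>R b) = u *\<^sub>R Y a + v *\<^sub>R Y b"
      by (simp add: Y_def v algebra_simps diff_divide_distrib)
    then have "G (Y (u *\<^sub>R a + v *\<^sub>R b)) \<le> u * G (Y a) + v * G (Y b)"
      using G uv by (simp add: convex_on_def)
    also have "\<dots> \<le> u * (c + (2 * l / m) * ((a - p) \<bullet> x)) + v * (c + (2 * l / m) * ((b - p) \<bullet> x))"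
      using ab uv by (intro add_mono mult_left_mono) (auto simp: S_def)
    also have "\<dots> = c + (2 * l / m) * ((u *\<^sub>R a + v *\<^sub>R b - p) \<bullet> x)"
      by (simp add: v inner_simps algebra_simps diff_divide_distrib add_divide_distrib)
    finally show "u *\<^sub>R a + v *\<^sub>R b \<in> S" by (simp add: S_def)
  qed
  moreover have "nearest_points K x \<subseteq> S"
  proof
    fix k assume "k \<in> nearest_points K x"
    then have k: "k \<in> K" and r: "norm (k - x) = infdist x K"
      using nearest_points_iff[OF K] by (auto simp: dist_norm norm_minus_commute)
    have "infdist (Y k) K \<le> norm (Y k - k)" using infdist_le[OF k] by (simp add: dist_norm)
    then have "F (Y k) \<le> (norm (Y k - k))\<^sup>2 + l * (norm (Y k))\<^sup>2"
      by (simp add: F_def power_mono infdist_nonneg)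
    also have "\<dots> = c + (2 * l / m) * ((k - p) \<bullet> x)"
    proof -
      define z where "z = Y k - x"
      have mz: "m *\<^sub>R z = k - p" using m by (simp add: z_def Y_def)
      have "(norm (Y k - k))\<^sup>2 + l * (norm (Y k))\<^sup>2
          = m * (z \<bullet> z) - 2 * (z \<bullet> (k - x)) + (norm (k - x))\<^sup>2 + 2 * l * (z \<bullet> x) + l * (norm x)\<^sup>2"
        by (simp add: z_def m_def power2_norm_eq_inner inner_diff inner_commute algebra_simps)
      \<comment> \<open>Multiplying by \<open>m\<close> turns \<open>m *\<^sub>R z\<close> into
        \<open>k - p\<close>, after which the mixed products of \<open>k - x\<close> and
        \<open>p - x\<close> cancel.\<close>
      also have "m * (m * (z \<bullet> z) - 2 * (z \<bullet> (k - x)))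
          = (m *\<^sub>R z) \<bullet> (m *\<^sub>R z) - 2 * ((m *\<^sub>R z) \<bullet> (k - x))"
        by (simp add: algebra_simps)
      then have "m * (m * (z \<bullet> z) - 2 * (z \<bullet> (k - x))) = (norm (p - x))\<^sup>2 - (infdist x K)\<^sup>2"
        unfolding mz r[symmetric]
        by (simp add: power2_norm_eq_inner inner_diff inner_commute algebra_simps)
      then have "m * (z \<bullet> z) - 2 * (z \<bullet> (k - x)) = ((norm (p - x))\<^sup>2 - (infdist x K)\<^sup>2) / m"
        using m by (simp add: field_simps)
      moreover have "z \<bullet> x = ((k - p) \<bullet> x) / m"
        using m by (simp add: z_def Y_def)
      ultimately show ?thesis by (simp add: c_def r)
    qed
    finally show "k \<in> S" using GF[of "Y k"] by (simp add: S_def)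
  qed
  ultimately have "p \<in> S" using p hull_minimal by blast
  then show ?thesis by (simp add: S_def Y_def G_def F_def c_def m_def)
qed

lemma convex_envelope_infdist_sq_ge:
  fixes K :: "(real^'n) set"
  assumes K: "K \<noteq> {}" "closed K" and l: "l > 0"
    and sep: "\<And>k. k \<in> K \<Longrightarrow> - e \<le>
      l * ((norm (k - x))\<^sup>2 - (infdist x K)\<^sup>2) + 2 * ((k - x) \<bullet> q) - 2 * (norm q)\<^sup>2"
  shows "(infdist x K)\<^sup>2 + l * (norm x)\<^sup>2 + ((norm q)\<^sup>2 - (infdist x K)\<^sup>2 - e) / (1 + l)
    \<le> convex_envelope (\<lambda>y. (infdist y K)\<^sup>2 + l * (norm y)\<^sup>2) x"
proof -
  define F where "F = (\<lambda>y::real^'n. (infdist y K)\<^sup>2 + l * (norm y)\<^sup>2)"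
  define r where "r = infdist x K"
  define m where "m = 1 + l"
  have m: "m > 0" using l by (simp add: m_def)
  have bdd: "bdd_below (range F)"
    unfolding F_def using l by (intro bdd_below_infdist_sq_plus) simp
  define c where "c = r\<^sup>2 + l * (norm x)\<^sup>2 + ((norm q)\<^sup>2 - r\<^sup>2 - e) / m"
  \<comment> \<open>The slope \<open>2 * l * x\<close> is the gradient of
    \<open>l * (norm y)\<^sup>2\<close> at \<open>y = x\<close>, so in \<open>F - g\<close> only the
    correction by \<open>q\<close> is left beside the terms in \<open>z\<close> and
    \<open>j\<close>.\<close>
  define g where "g = (\<lambda>y. c + (2 * l) * (x \<bullet> (y - x)) - 2 * (q \<bullet> (y - x)))"
  have "convex_on UNIV g"
  proof (rule convex_onI)
    fix t :: real and a b :: "real^'n"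
    show "g ((1 - t) *\<^sub>R a + t *\<^sub>R b) \<le> (1 - t) * g a + t * g b"
      by (simp add: g_def inner_simps algebra_simps)
  qed simp
  moreover have "g \<le> F"
  proof (rule le_funI)
    fix y
    obtain k where k: "k \<in> K" "infdist y K = dist y k"
      using infdist_attains_inf[OF K(2,1)] by metis
    define z j where "z = y - x" and "j = k - x"
    have F: "F y = m * (z \<bullet> z) - 2 * (z \<bullet> j) + (norm j)\<^sup>2 + 2 * l * (z \<bullet> x) + l * (norm x)\<^sup>2"
      by (simp add: F_def k dist_norm z_def j_def m_def power2_norm_eq_inner inner_diff
          inner_commute algebra_simps)
    \<comment> \<open>Completing the square in \<open>z\<close> removes the dependence on
      \<open>y\<close>; what remains to be shown is exactly \<open>sep\<close> for the point
      \<open>k\<close>.\<close>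
    have "0 \<le> (m *\<^sub>R z - (j - q)) \<bullet> (m *\<^sub>R z - (j - q))" by simp
    also have "\<dots> = m * (m * (z \<bullet> z) - 2 * (z \<bullet> j) + 2 * (q \<bullet> z)) + (norm (j - q))\<^sup>2"
      by (simp add: power2_norm_eq_inner inner_diff inner_commute algebra_simps)
    finally have "0 \<le> m * (m * (z \<bullet> z) - 2 * (z \<bullet> j) + 2 * (q \<bullet> z))
        + ((norm j)\<^sup>2 - 2 * (j \<bullet> q) + (norm q)\<^sup>2)"
      by (simp add: power2_norm_eq_inner inner_diff inner_commute algebra_simps)
    moreover have "- e \<le> l * ((norm j)\<^sup>2 - r\<^sup>2) + 2 * (j \<bullet> q) - 2 * (norm q)\<^sup>2"
      using sep[OF k(1)] by (simp add: j_def r_def)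
    then have "- e \<le> m * ((norm j)\<^sup>2 - r\<^sup>2) - ((norm j)\<^sup>2 - r\<^sup>2) + 2 * (j \<bullet> q) - 2 * (norm q)\<^sup>2"
      by (simp add: m_def algebra_simps)
    ultimately have "(norm q)\<^sup>2 - r\<^sup>2 - e
        \<le> m * (m * (z \<bullet> z) - 2 * (z \<bullet> j) + 2 * (q \<bullet> z)) + m * ((norm j)\<^sup>2 - r\<^sup>2)"
      by linarith
    then have "((norm q)\<^sup>2 - r\<^sup>2 - e) / m
        \<le> m * (z \<bullet> z) - 2 * (z \<bullet> j) + 2 * (q \<bullet> z) + ((norm j)\<^sup>2 - r\<^sup>2)"
      using m by (simp add: pos_divide_le_eq distrib_left mult.commute[of _ m])
    then show "g y \<le> F y"
      unfolding F by (simp add: g_def c_def inner_commute[of x] flip: z_def)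
  qed
  ultimately have "g \<le> convex_envelope F" using convex_envelope_SUP(4)[OF bdd] by blast
  then have "g x \<le> convex_envelope F x" by (rule le_funD)
  then show ?thesis by (simp add: g_def c_def m_def r_def F_def)
qed

text \<open>\<open>K\<close> may be unbounded, so compactness gives no uniform threshold for
  \<open>l\<close>. Instead the penalty, of order \<open>l * d * norm (k - x)\<close> on the bad set
  \<open>A\<close>, outgrows the inner product, which is at most linear in
  \<open>norm (k - x)\<close>.\<close>

lemma eventually_penalized_inner_ge:
  fixes K :: "(real^'n) set"
  assumes K: "K \<noteq> {}" "closed K" and e: "e > 0"
    and q: "norm q \<le> infdist x K"
    and near: "\<And>k. k \<in> nearest_points K x \<Longrightarrow> (norm q)\<^sup>2 \<le> (k - x) \<bullet> q"
  shows "\<forall>\<^sub>F l in at_top. \<forall>k\<in>K. - e \<le>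
      l * ((norm (k - x))\<^sup>2 - (infdist x K)\<^sup>2) + 2 * ((k - x) \<bullet> q) - 2 * (norm q)\<^sup>2"
proof -
  define r where "r = infdist x K"
  have r0: "r \<ge> 0" by (simp add: r_def infdist_nonneg)
  have rk: "r \<le> norm (k - x)" if "k \<in> K" for k
    using infdist_le[OF that, of x] by (simp add: r_def dist_norm norm_minus_commute)
  define A where "A = {k \<in> K. (k - x) \<bullet> q \<le> (norm q)\<^sup>2 - e / 2}"
  have "A = K \<inter> {k. (k - x) \<bullet> q \<le> (norm q)\<^sup>2 - e / 2}" by (auto simp: A_def)
  then have clA: "closed A" using K(2)
    by (auto intro!: closed_Int closed_Collect_le continuous_intros)
  obtain d where d: "d > 0" "\<And>k. k \<in> A \<Longrightarrow> r + d \<le> norm (k - x)"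
  proof (cases "A = {}")
    case True
    then show ?thesis using that[of 1] by simp
  next
    case False
    obtain a where a: "a \<in> A" "infdist x A = dist x a"
      using infdist_attains_inf[OF clA False] by metis
    \<comment> \<open>Nearest points satisfy \<open>near\<close> and so miss the bound defining
      \<open>A\<close> by at least \<open>e / 2\<close>.\<close>
    have "a \<notin> nearest_points K x" using near[of a] a(1) e by (auto simp: A_def)
    then have "dist x a > r"
      using a(1) rk[of a] nearest_points_iff[OF K(1), of a x]
      by (auto simp: A_def r_def dist_norm norm_minus_commute)
    moreover have "dist x a \<le> norm (k - x)" if "k \<in> A" for k
      using infdist_le[OF that, of x] a(2) by (simp add: dist_norm norm_minus_commute)
    ultimately show ?thesis using that[of "dist x a - r"] by simp
  qed
  have "- e \<le> l * ((norm (k - x))\<^sup>2 - r\<^sup>2) + 2 * ((k - x) \<bullet> q) - 2 * (norm q)\<^sup>2"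
    if l: "l \<ge> 2 * r / d" and k: "k \<in> K" for l k
  proof -
    have l0: "l \<ge> 0" using l r0 d(1) by (meson divide_nonneg_pos mult_nonneg_nonneg order_trans zero_le_numeral)
    have sq: "(norm (k - x))\<^sup>2 - r\<^sup>2 = (norm (k - x) - r) * (norm (k - x) + r)"
      by (simp add: power2_eq_square algebra_simps)
    show ?thesis
    proof (cases "k \<in> A")
      case False
      then have "(k - x) \<bullet> q > (norm q)\<^sup>2 - e / 2" using k by (auto simp: A_def)
      moreover have "l * ((norm (k - x))\<^sup>2 - r\<^sup>2) \<ge> 0"
        using l0 rk[OF k] r0 unfolding sq by simp
      ultimately show ?thesis by linarith
    next
      case True
      \<comment> \<open>The threshold \<open>2 * r / d\<close> makes the penalty at least
        \<open>2 * r * (norm (k - x) + r)\<close>, which absorbs both the inner product and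
        \<open>2 * (norm q)\<^sup>2\<close>, as \<open>norm q \<le> r\<close>.\<close>
      have "2 * r \<le> l * d" using l d(1) by (simp add: pos_divide_le_eq)
      also have "\<dots> \<le> l * (norm (k - x) - r)" using d(2)[OF True] l0 by (intro mult_left_mono) auto
      finally have "2 * r * (norm (k - x) + r) \<le> l * ((norm (k - x))\<^sup>2 - r\<^sup>2)"
        unfolding sq mult.assoc[symmetric] using r0 by (intro mult_right_mono) auto
      moreover have "\<bar>(k - x) \<bullet> q\<bar> \<le> norm (k - x) * r"
        using Cauchy_Schwarz_ineq2[of "k - x" q] q
        by (metis mult_left_mono norm_ge_zero order_trans r_def)
      moreover have "(norm q)\<^sup>2 \<le> r * r"
        using q r0 by (simp add: power2_eq_square mult_mono r_def)
      ultimately show ?thesis using e by (simp add: algebra_simps abs_le_iff)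
    qed
  qed
  then show ?thesis
    unfolding r_def[symmetric] by (intro eventually_mono[OF eventually_ge_at_top[of "2 * r / d"]]) blast
qed

theorem theorem3p23:
  fixes K :: "(real^'n) set" and x :: "real^'n"
  assumes "K \<noteq> {}" and "closed K"
  shows "((\<lambda>l. multiscale_medial_axis_map l K x) \<longlongrightarrow> medial_axis_landscape_map K x) at_top"
proof -
  obtain p where p: "p \<in> convex hull nearest_points K x"
    and landscape: "medial_axis_landscape_map K x = (infdist x K)\<^sup>2 - (norm (p - x))\<^sup>2"
    and near: "\<And>k. k \<in> nearest_points K x \<Longrightarrow> (norm (p - x))\<^sup>2 \<le> (k - x) \<bullet> (p - x)"
    using medial_axis_landscape_map_closest_point[OF assms] by metis
  have "convex hull nearest_points K x \<subseteq> cball x (infdist x K)"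
    by (rule hull_minimal) (auto simp: nearest_points_def)
  then have pr: "norm (p - x) \<le> infdist x K"
    using p by (auto simp: dist_norm norm_minus_commute)
  let ?E = "\<lambda>l. convex_envelope (\<lambda>y. (infdist y K)\<^sup>2 + l * (norm y)\<^sup>2) x"
  have M: "multiscale_medial_axis_map l K x
      = (1 + l) * ((infdist x K)\<^sup>2 + l * (norm x)\<^sup>2 - ?E l)" for l
    by (simp add: multiscale_medial_axis_map_def lower_transform_def algebra_simps)
  \<comment> \<open>The factor \<open>1 + l\<close> in \<open>M\<close> cancels the denominator of
    the envelope bound, so this direction needs no limit.\<close>
  have lower: "medial_axis_landscape_map K x \<le> multiscale_medial_axis_map l K x" if "l > 0" for l
    using convex_envelope_infdist_sq_le[OF assms(1) that p] that
    unfolding M landscape by (simp add: field_simps)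
  have upper: "\<forall>\<^sub>F l in at_top. multiscale_medial_axis_map l K x \<le> medial_axis_landscape_map K x + e"
    if "e > 0" for e
    using eventually_penalized_inner_ge[OF assms that pr near, simplified] eventually_gt_at_top[of 0]
  proof eventually_elim
    case (elim l)
    then have "(infdist x K)\<^sup>2 + l * (norm x)\<^sup>2 + ((norm (p - x))\<^sup>2 - (infdist x K)\<^sup>2 - e) / (1 + l) \<le> ?E l"
      by (intro convex_envelope_infdist_sq_ge[OF assms]) auto
    then show ?case using elim(2) unfolding M landscape by (simp add: field_simps)
  qed
  show ?thesis
  proof (rule tendstoI)
    fix e :: real assume "e > 0"
    then have "e / 2 > 0" by simp
    from upper[OF this] eventually_gt_at_top[of 0]
    show "\<forall>\<^sub>F l in at_top. dist (multiscale_medial_axis_map l K x) (medial_axis_landscape_map K x) < e"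
    proof eventually_elim
      case (elim l)
      then show ?case using lower[OF elim(2)] \<open>e > 0\<close> by (simp add: dist_real_def)
    qed
  qed
qed

end
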